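(* Every $n$-vertex plane graph $G=(V,E)$ has a vertex set $V'\subseteq V$ with $|V'|\ge n/2$ such that the induced plane graph $G[V']$ is an outerplane graph.
   Context: A plane graph is a planar graph together with a plane embedding, i.e., an equivalence class of planar drawings having the same rotation scheme at every vertex, the same facial cycles for every face, and the same outer face. For $V'\subseteq V$, the induced plane graph $G[V']$ is the subgraph of $G$ induced by $V'$ together with the embedding inherited from $G$ (obtained by deleting from the embedding of $G$ all vertices and edges not in $G[V']$). A plane graph is outerplane if all its vertices are incident to its outer face. *)

theory Defs
  imports "HOL-Analysis.Analysis"
begin

definition simple_graph :: "'v set \<Rightarrow> 'v set set \<Rightarrow> bool" where
  "simple_graph V E \<longleftrightarrow> finite V \<and> (\<forall>e\<in>E. e \<subseteq> V \<and> card e = 2)"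

text \<open>A planar drawing of (V,E) in the plane (identified with the complex numbers):
  vertices are mapped injectively to points, each edge is drawn as a Jordan arc
  joining the images of its two endpoints, an arc contains no vertex other than its
  endpoints, and two distinct arcs meet only in common endpoints.
  A plane graph is a graph together with such a drawing (its embedding is the one
  determined by the drawing).\<close>
definition plane_drawing ::
  "'v set \<Rightarrow> 'v set set \<Rightarrow> ('v \<Rightarrow> complex) \<Rightarrow> ('v set \<Rightarrow> real \<Rightarrow> complex) \<Rightarrow> bool" where
  "plane_drawing V E pos \<gamma> \<longleftrightarrow>
     simple_graph V E \<and> inj_on pos V \<and>
     (\<forall>e\<in>E. arc (\<gamma> e) \<and> {pathstart (\<gamma> e), pathfinish (\<gamma> e)} = pos ` e \<and>
             path_image (\<gamma> e) \<inter> pos ` V = pos ` e) \<and>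
     (\<forall>e\<in>E. \<forall>f\<in>E. e \<noteq> f \<longrightarrow> path_image (\<gamma> e) \<inter> path_image (\<gamma> f) \<subseteq> pos ` (e \<inter> f))"

definition drawing_points ::
  "'v set \<Rightarrow> 'v set set \<Rightarrow> ('v \<Rightarrow> complex) \<Rightarrow> ('v set \<Rightarrow> real \<Rightarrow> complex) \<Rightarrow> complex set" where
  "drawing_points V E pos \<gamma> = pos ` V \<union> (\<Union>e\<in>E. path_image (\<gamma> e))"

definition induced_edges :: "'v set set \<Rightarrow> 'v set \<Rightarrow> 'v set set" where
  "induced_edges E V' = {e\<in>E. e \<subseteq> V'}"

text \<open>The outer face is the unbounded component of the complement of the drawing;
  the drawing is outerplane if every vertex lies on the boundary of the outer face.\<close>
definition outerplane_drawing ::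
  "'v set \<Rightarrow> 'v set set \<Rightarrow> ('v \<Rightarrow> complex) \<Rightarrow> ('v set \<Rightarrow> real \<Rightarrow> complex) \<Rightarrow> bool" where
  "outerplane_drawing V E pos \<gamma> \<longleftrightarrow>
     (\<forall>v\<in>V. pos v \<in> frontier (outside (drawing_points V E pos \<gamma>)))"

end

theory Submission
  imports Defs
begin

text \<open>Call two vertices cofacial if they lie on a common face. Deleting a vertex on the outer face
  merges all faces around it with the outer face and so exposes all vertices cofacial with it.
  Hence it suffices to delete at most half of the vertices, one after the other and each of them
  exposed when it is deleted, such that in the end all vertices have been exposed.

  Let a deletion cost 2 and let every newly exposed vertex repay 1. A cofacially connected set
  \<open>J\<close> of unexposed vertices can be exposed at cost at most 1, and at cost at most 0 if one of
  its exposed neighbours is deleted for free; by parity the latter cost is at most \<open>-1\<close> if \<open>J\<close>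
  is odd. Both bounds are proved by simultaneous induction on the size of \<open>J\<close>. After a deletion
  the newly exposed set \<open>K\<close> has repaid its size, and each remaining component of \<open>J\<close> is attached
  to some \<open>c \<in> K\<close>. If \<open>b\<close> odd components are attached to \<open>c\<close>, they cost \<open>b\<close> separately and
  \<open>2 - b\<close> if \<open>c\<close> is deleted too, hence at most 1. For even \<open>J\<close> one deletes a vertex with at
  least two neighbours in \<open>J\<close>. Such a vertex exists since the plane without the vertices of the
  drawing is connected, so that a face with all its vertices in \<open>J\<close> shares an edge with a face
  for which this fails.

  Starting from the outer face, the \<open>k\<close> outer vertices repay \<open>k\<close> and the rest costs at most
  \<open>k\<close>, so the number of deletions is at most half the number of vertices.\<close>

section \<open>Exposing vertices by deletions\<close>

text \<open>Here \<open>X\<close> are the vertices exposed from the start and \<open>W\<close> the deleted ones; an element of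
  \<open>W\<close> has an effect only once it is exposed itself.\<close>

inductive_set exposed :: "('a \<Rightarrow> 'a \<Rightarrow> bool) \<Rightarrow> 'a set \<Rightarrow> 'a set \<Rightarrow> 'a set"
  for R :: "'a \<Rightarrow> 'a \<Rightarrow> bool" and X W :: "'a set" where
  start: "x \<in> X \<Longrightarrow> x \<in> exposed R X W"
| step: "w \<in> exposed R X W \<Longrightarrow> w \<in> W \<Longrightarrow> R w v \<Longrightarrow> v \<in> exposed R X W"

lemma exposed_trans:
  assumes "v \<in> exposed R Y W" "Y \<subseteq> exposed R X W'" "W \<subseteq> W'"
  shows "v \<in> exposed R X W'"
  using assms(1)
proof induction
  case (start x)
  then show ?case using assms by blast
next
  case (step w v)
  then show ?case using assms by (meson exposed.step subsetD)
qed

lemma exposed_mono: "X \<subseteq> X' \<Longrightarrow> W \<subseteq> W' \<Longrightarrow> exposed R X W \<subseteq> exposed R X' W'"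
  by (meson exposed.start exposed_trans subset_iff)

text \<open>The vertices of \<open>Z\<close> are deleted for free; each of the others costs 2.\<close>

definition covers :: "('a \<Rightarrow> 'a \<Rightarrow> bool) \<Rightarrow> 'a set \<Rightarrow> 'a set \<Rightarrow> 'a set \<Rightarrow> nat \<Rightarrow> bool" where
  "covers R Z X J m \<longleftrightarrow> (\<exists>W. finite W \<and> 2 * card W \<le> m \<and> J \<subseteq> exposed R X (Z \<union> W))"

lemma covers_mono: "covers R Z X J m \<Longrightarrow> X \<subseteq> X' \<Longrightarrow> m \<le> m' \<Longrightarrow> covers R Z X' J m'"
  unfolding covers_def by (meson exposed_mono order.trans subset_refl)

lemma covers_empty: "covers R Z X {} m"
  unfolding covers_def by (rule exI[of _ "{}"]) auto

text \<open>Twice the number of deletions is even, so an odd budget is never exhausted.\<close>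

lemma covers_parity:
  assumes "covers R Z X J m" "odd m"
  shows "covers R Z X J (m - 1)"
proof -
  have "2 * k \<le> m - 1" if "2 * k \<le> m" for k
    using that assms(2) by presburger
  then show ?thesis
    using assms(1) unfolding covers_def by blast
qed

lemma covers_Un:
  assumes "covers R Z X A m" "covers R Z (X \<union> A) B k"
  shows "covers R Z X (A \<union> B) (m + k)"
proof -
  obtain W1 W2 where W: "finite W1" "2 * card W1 \<le> m" "A \<subseteq> exposed R X (Z \<union> W1)"
      "finite W2" "2 * card W2 \<le> k" "B \<subseteq> exposed R (X \<union> A) (Z \<union> W2)"
    using assms unfolding covers_def by blast
  let ?W = "Z \<union> (W1 \<union> W2)"
  have A: "X \<union> A \<subseteq> exposed R X ?W"
    using W(3) exposed_mono[of X X "Z \<union> W1" ?W R] by (auto intro: exposed.start)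
  then have "B \<subseteq> exposed R X ?W"
    using W(6) exposed_trans[of _ R "X \<union> A" "Z \<union> W2" X ?W] by auto
  moreover have "2 * card (W1 \<union> W2) \<le> m + k"
    using card_Un_le[of W1 W2] W(2,5) by linarith
  ultimately show ?thesis
    unfolding covers_def using A W(1,4) by (intro exI[of _ "W1 \<union> W2"]) auto
qed

lemma covers_Union:
  assumes "finite \<J>" "\<And>J. J \<in> \<J> \<Longrightarrow> covers R Z X J (f J)"
  shows "covers R Z X (\<Union>\<J>) (sum f \<J>)"
  using assms
proof (induction rule: finite_induct)
  case empty
  then show ?case by (simp add: covers_empty)
next
  case (insert J \<J>)
  then have "covers R Z X (J \<union> \<Union>\<J>) (f J + sum f \<J>)"
    by (intro covers_Un) (auto intro: covers_mono)
  then show ?case using insert.hyps by simp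
qed

lemma covers_delete:
  assumes "covers R {c} X J m"
  shows "covers R {} X J (m + 2)"
proof -
  obtain W where W: "finite W" "2 * card W \<le> m" "J \<subseteq> exposed R X ({c} \<union> W)"
    using assms unfolding covers_def by blast
  have "card (insert c W) \<le> Suc (card W)"
    using W(1) by (simp add: card_insert_if)
  then show ?thesis
    unfolding covers_def using W by (intro exI[of _ "insert c W"]) auto
qed

text \<open>A net cost of 1 or 0 becomes \<open>card J + 1\<close> or \<open>card J\<close>, because
  \<open>covers\<close> bounds the full price and \<open>J\<close> repays
  \<open>card J\<close>.\<close>

definition cheap :: "('a \<Rightarrow> 'a \<Rightarrow> bool) \<Rightarrow> 'a set \<Rightarrow> 'a set \<Rightarrow> bool" where
  "cheap R X J \<longleftrightarrow> covers R {} X J (card J + 1) \<and>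
     (\<forall>c\<in>X. (\<exists>a\<in>J. R c a) \<longrightarrow> covers R {c} X J (card J))"

text \<open>With at most one odd set in the family each set is paid for separately; with
  two or more it is better to delete \<open>c\<close>, which saves one half on every odd set.\<close>

lemma covers_star:
  assumes "finite \<S>" "c \<in> X"
    and "\<And>J. J \<in> \<S> \<Longrightarrow> cheap R X J \<and> (\<exists>a\<in>J. R c a)"
  shows "covers R {} X (\<Union>\<S>)
    (sum card \<S> + (if card {J\<in>\<S>. odd (card J)} = 1 then 1 else 0))"
proof -
  let ?b = "card {J\<in>\<S>. odd (card J)}"
  let ?p = "\<lambda>J::'a set. if odd (card J) then 1 else (0::nat)"
  have b: "sum ?p \<S> = ?b"
    using assms(1) by (simp add: sum.If_cases Int_def)
  show ?thesis
  proof (cases "?b \<le> 1")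
    case True
    have "covers R {} X J (card J + ?p J)" if "J \<in> \<S>" for J
    proof (cases "odd (card J)")
      case True
      then show ?thesis using assms(3)[OF that] by (simp add: cheap_def)
    next
      case False
      then show ?thesis
        using assms(3)[OF that] covers_parity[of R "{}" X J "card J + 1"] by (simp add: cheap_def)
    qed
    then have "covers R {} X (\<Union>\<S>) (\<Sum>J\<in>\<S>. card J + ?p J)"
      by (intro covers_Union assms(1))
    then have "covers R {} X (\<Union>\<S>) (sum card \<S> + ?b)"
      by (simp only: sum.distrib b)
    then show ?thesis
      by (rule covers_mono) (use True in auto)
  next
    case False
    have "covers R {c} X J (card J - ?p J)" if "J \<in> \<S>" for J
      using assms(2) assms(3)[OF that] covers_parity[of R "{c}" X J "card J"]
      by (auto simp: cheap_def)
    then have "covers R {c} X (\<Union>\<S>) (\<Sum>J\<in>\<S>. card J - ?p J)"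
      by (intro covers_Union assms(1))
    moreover have "(\<Sum>J\<in>\<S>. card J - ?p J) + ?b = sum card \<S>"
      unfolding b[symmetric] sum.distrib[symmetric]
      by (intro sum.cong refl) (auto elim: oddE)
    ultimately have "covers R {} X (\<Union>\<S>) ((\<Sum>J\<in>\<S>. card J - ?p J) + 2)"
        "(\<Sum>J\<in>\<S>. card J - ?p J) + 2 \<le> sum card \<S>"
      using False by (simp_all only: covers_delete)
    then show ?thesis by (blast intro: covers_mono trans_le_add1)
  qed
qed

text \<open>Peel off the vertices of \<open>K\<close> one by one: the sets attached to
  \<open>c\<close> form a star, whose price exceeds the repayment by at most 1.\<close>

lemma covers_stars:
  assumes "finite K" "finite \<J>" "K \<subseteq> X"
    and "\<And>J. J \<in> \<J> \<Longrightarrow> cheap R X J \<and> (\<exists>c\<in>K. \<exists>a\<in>J. R c a)"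
  shows "covers R {} X (\<Union>\<J>) (sum card \<J> + card K)"
  using assms
proof (induction arbitrary: \<J> rule: finite_induct)
  case empty
  then have "\<J> = {}" by auto
  then show ?case by (simp add: covers_empty)
next
  case (insert c K)
  define \<S> where "\<S> = {J\<in>\<J>. \<exists>a\<in>J. R c a}"
  have *: "covers R {} X (\<Union>\<S>) (sum card \<S> + 1)"
    by (rule covers_mono[OF covers_star[of \<S> c X R]]) (use insert.prems in \<open>auto simp: \<S>_def\<close>)
  have "covers R {} X (\<Union>(\<J> - \<S>)) (sum card (\<J> - \<S>) + card K)"
  proof (rule insert.IH)
    fix J assume "J \<in> \<J> - \<S>"
    then show "cheap R X J \<and> (\<exists>c\<in>K. \<exists>a\<in>J. R c a)"
      using insert.prems(3)[of J] by (auto simp: \<S>_def)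
  qed (use insert.prems in auto)
  then have "covers R {} (X \<union> \<Union>\<S>) (\<Union>(\<J> - \<S>)) (sum card (\<J> - \<S>) + card K)"
    by (rule covers_mono) auto
  note covers_Un[OF * this]
  moreover have "\<Union>\<S> \<union> \<Union>(\<J> - \<S>) = \<Union>\<J>"
    by (auto simp: \<S>_def)
  moreover have "sum card \<J> = sum card \<S> + sum card (\<J> - \<S>)"
    using insert.prems by (metis (no_types, lifting) \<S>_def add.commute mem_Collect_eq subsetI sum.subset_diff)
  ultimately show ?case
    using insert.hyps by (simp add: ac_simps)
qed

text \<open>A star without exactly one odd set has no excess, so \<open>c\<close> contributes
  nothing. Sets attached to other vertices of \<open>K\<close> as well may be left out of the
  star.\<close>

lemma covers_stars_strict:
  assumes "finite K" "finite \<J>" "K \<subseteq> X" "c \<in> K"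
    and \<J>: "\<And>J. J \<in> \<J> \<Longrightarrow> cheap R X J"
    and \<S>: "\<S> \<subseteq> \<J>" "\<And>J. J \<in> \<S> \<Longrightarrow> \<exists>a\<in>J. R c a" "card {J\<in>\<S>. odd (card J)} \<noteq> 1"
    and rest: "\<And>J. J \<in> \<J> - \<S> \<Longrightarrow> \<exists>d\<in>K - {c}. \<exists>a\<in>J. R d a"
  shows "covers R {} X (\<Union>\<J>) (sum card \<J> + card K - 1)"
proof -
  have fin: "finite \<S>" using assms(2) \<S>(1) finite_subset by blast
  have *: "covers R {} X (\<Union>\<S>) (sum card \<S>)"
    using covers_star[OF fin, of c X R] assms by auto
  have "covers R {} X (\<Union>(\<J> - \<S>)) (sum card (\<J> - \<S>) + card (K - {c}))"
    using assms by (intro covers_stars) auto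
  then have "covers R {} (X \<union> \<Union>\<S>) (\<Union>(\<J> - \<S>)) (sum card (\<J> - \<S>) + card (K - {c}))"
    by (rule covers_mono) auto
  note covers_Un[OF * this]
  moreover have "\<Union>\<S> \<union> \<Union>(\<J> - \<S>) = \<Union>\<J>"
    using \<S>(1) by auto
  moreover have "sum card \<J> = sum card \<S> + sum card (\<J> - \<S>)"
    using assms(2) \<S>(1) by (metis add.commute sum.subset_diff)
  moreover have "card K = Suc (card (K - {c}))"
    using assms(1,4) by (rule card.remove)
  ultimately show ?thesis by (simp add: add.assoc)
qed

section \<open>Connected sets and components of a relation\<close>

text \<open>Stated by cuts rather than paths, since it serves to find an edge leaving a proper
  subset.\<close>

definition conn :: "('a \<Rightarrow> 'a \<Rightarrow> bool) \<Rightarrow> 'a set \<Rightarrow> bool" where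
  "conn R J \<longleftrightarrow> J \<noteq> {} \<and> (\<forall>A. A \<subseteq> J \<longrightarrow> A \<noteq> {} \<longrightarrow> A \<noteq> J \<longrightarrow> (\<exists>a\<in>A. \<exists>b\<in>J - A. R a b))"

definition comps :: "('a \<Rightarrow> 'a \<Rightarrow> bool) \<Rightarrow> 'a set \<Rightarrow> 'a set set" where
  "comps R I = (\<lambda>x. {y. (x, y) \<in> {(a, b). a \<in> I \<and> b \<in> I \<and> R a b}\<^sup>*}) ` I"

lemma comps_subset: "J \<in> comps R I \<Longrightarrow> J \<subseteq> I"
  unfolding comps_def by (auto elim: rtranclE)

lemma Union_comps: "\<Union>(comps R I) = I"
proof
  show "\<Union>(comps R I) \<subseteq> I" using comps_subset by blast
  show "I \<subseteq> \<Union>(comps R I)" by (auto simp: comps_def)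
qed

lemma finite_comps: "finite I \<Longrightarrow> finite (comps R I)"
  unfolding comps_def by simp

lemma comps_closed:
  assumes "J \<in> comps R I" "a \<in> J" "b \<in> I" "R a b"
  shows "b \<in> J"
proof -
  have "a \<in> I" using assms comps_subset by fast
  then show ?thesis
    using assms unfolding comps_def by (auto intro: rtrancl_into_rtrancl)
qed

lemma conn_comps:
  assumes "symp R" "J \<in> comps R I"
  shows "conn R J"
  unfolding conn_def
proof (intro conjI allI impI)
  define S where "S = {(a, b). a \<in> I \<and> b \<in> I \<and> R a b}"
  obtain x where x: "x \<in> I" "J = {y. (x, y) \<in> S\<^sup>*}"
    using assms(2) unfolding comps_def S_def by auto
  have "sym (S\<^sup>*)"
    using assms(1) by (intro sym_rtrancl) (auto simp: S_def sym_def symp_def)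
  show "J \<noteq> {}" using x by auto
  fix A assume A: "A \<subseteq> J" "A \<noteq> {}" "A \<noteq> J"
  then obtain a b where ab: "a \<in> A" "b \<in> J - A" by blast
  then have "(a, b) \<in> S\<^sup>*"
    using A x \<open>sym (S\<^sup>*)\<close> by (auto dest: symD intro: rtrancl_trans)
  have "\<exists>a\<in>A. \<exists>b\<in>J - A. R a b" if "(a, b) \<in> S\<^sup>*" "a \<in> A" "b \<in> J - A" for a b
    using that
  proof (induction rule: rtrancl_induct)
    case base
    then show ?case by blast
  next
    case (step y z)
    show ?case
    proof (cases "y \<in> A")
      case True
      then show ?thesis using step by (auto simp: S_def)
    next
      case False
      have "(x, a) \<in> S\<^sup>*" using A step.prems x by blast
      then have "y \<in> J" using step.hyps x by auto
      then show ?thesis using False step by blast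
    qed
  qed
  then show "\<exists>a\<in>A. \<exists>b\<in>J - A. R a b"
    using ab \<open>(a, b) \<in> S\<^sup>*\<close> by blast
qed

lemma disjoint_comps:
  assumes "symp R" "J \<in> comps R I" "J' \<in> comps R I" "J \<noteq> J'"
  shows "J \<inter> J' = {}"
proof -
  have "A \<subseteq> B" if AB: "A \<in> comps R I" "B \<in> comps R I" "A \<inter> B \<noteq> {}" for A B
  proof (rule ccontr)
    assume "\<not> A \<subseteq> B"
    then have "A \<inter> B \<noteq> A" by blast
    then obtain a b where "a \<in> A \<inter> B" "b \<in> A - A \<inter> B" "R a b"
      using conn_comps[OF assms(1) AB(1)] AB(3) unfolding conn_def
      by (meson Int_lower1)
    then show False
      using comps_closed[OF AB(2), of a b] comps_subset[OF AB(1)] by auto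
  qed
  then show ?thesis
    using assms by (metis Int_commute subset_antisym)
qed

lemma sum_card_comps:
  assumes "symp R" "finite I"
  shows "sum card (comps R I) = card I"
proof -
  have "card (\<Union>(comps R I)) = sum card (comps R I)"
  proof (rule card_Union_disjoint)
    show "pairwise disjnt (comps R I)"
      using disjoint_comps[OF assms(1)] by (auto simp: pairwise_def disjnt_def)
    show "finite J" if "J \<in> comps R I" for J
      using comps_subset[OF that] assms(2) finite_subset by blast
  qed
  then show ?thesis by (simp add: Union_comps)
qed

text \<open>Asking only for the vertices with two neighbours in \<open>J\<close>, rather than for all neighbours of
  \<open>J\<close>, to be exposed makes the condition pass to the sets \<open>insert c (j c)\<close> below.\<close>

definition ripe :: "('a \<Rightarrow> 'a \<Rightarrow> bool) \<Rightarrow> 'a set \<Rightarrow> 'a set \<Rightarrow> bool" where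
  "ripe R X J \<longleftrightarrow> conn R J \<and> (\<exists>x\<in>X. \<exists>a\<in>J. R x a) \<and>
     (\<forall>v. v \<notin> J \<longrightarrow> (\<exists>a\<in>J. \<exists>b\<in>J. a \<noteq> b \<and> R v a \<and> R v b) \<longrightarrow> v \<in> X)"

text \<open>Since \<open>J\<close> is connected, an edge leaves \<open>J'\<close>; it cannot end in
  \<open>J - K\<close>, so it ends in \<open>K\<close>. Likewise a vertex outside \<open>J'\<close>
  with two neighbours in \<open>J'\<close> lies in \<open>K\<close> or outside \<open>J\<close>, and
  in the latter case \<open>J\<close> being ripe puts it into \<open>X\<close>.\<close>

lemma ripe_comps:
  assumes "symp R" "ripe R X J" "J' \<in> comps R (J - K)" "K \<subseteq> J" "K \<noteq> {}"
  shows "ripe R (X \<union> K) J' \<and> (\<exists>c\<in>K. \<exists>a\<in>J'. R c a)"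
proof -
  have J': "conn R J'" "J' \<subseteq> J - K"
    using assms conn_comps comps_subset by blast+
  then have "J' \<noteq> J" "J' \<noteq> {}" using assms(4,5) by (auto simp: conn_def)
  then obtain a b where ab: "a \<in> J'" "b \<in> J - J'" "R a b"
    using assms(2) J'(2) unfolding ripe_def conn_def by (metis Diff_subset subset_trans)
  then have "b \<in> K" using comps_closed[OF assms(3), of a b] by blast
  then have adj: "\<exists>c\<in>K. \<exists>a\<in>J'. R c a" using ab assms(1) by (meson sympD)
  have "v \<in> X \<union> K" if v: "v \<notin> J'" "a \<in> J'" "b \<in> J'" "a \<noteq> b" "R v a" "R v b" for v a b
  proof (cases "v \<in> J")
    case True
    then show ?thesis
      using comps_closed[OF assms(3) v(2), of v] v assms(1) by (auto dest: sympD)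
  next
    case False
    then show ?thesis using assms(2) v J'(2) unfolding ripe_def by blast
  qed
  then show ?thesis using J' adj unfolding ripe_def by blast
qed

text \<open>For even \<open>J\<close> the deletion of a vertex \<open>v\<close> with neighbours \<open>K\<close> in \<open>J\<close> is too expensive only
  if every \<open>c \<in> K\<close> has exactly one odd component \<open>j c\<close> of \<open>J - K\<close> attached to it, and \<open>j c\<close>
  is attached to \<open>c\<close> only. In that case \<open>J\<close> is cut into the even sets \<open>insert c (j c)\<close> and the
  even components, and \<open>v\<close> need not be deleted at all.\<close>

lemma ripe_cheap:
  assumes R: "symp R"
    and two: "\<And>J. J \<subseteq> U \<Longrightarrow> conn R J \<Longrightarrow> 2 \<le> card J \<Longrightarrow>
      \<exists>v. v \<notin> J \<and> (\<exists>a\<in>J. \<exists>b\<in>J. a \<noteq> b \<and> R v a \<and> R v b)"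
    and "finite J" "J \<subseteq> U" "ripe R X J"
  shows "cheap R X J"
  using assms(3-)
proof (induction "card J" arbitrary: J X rule: less_induct)
  case less
  have J: "conn R J" "\<exists>x\<in>X. \<exists>a\<in>J. R x a"
    and J_two: "\<And>v a b. v \<notin> J \<Longrightarrow> a \<in> J \<Longrightarrow> b \<in> J \<Longrightarrow> a \<noteq> b \<Longrightarrow> R v a \<Longrightarrow> R v b \<Longrightarrow> v \<in> X"
    using less.prems(3) by (auto simp: ripe_def)
  have sub: "cheap R (X \<union> K) J' \<and> (\<exists>c\<in>K. \<exists>a\<in>J'. R c a)"
    if "J' \<in> comps R (J - K)" "K \<subseteq> J" "K \<noteq> {}" for K J'
  proof -
    have "J' \<subset> J" using comps_subset[OF that(1)] that(2,3) by blast
    then have "card J' < card J" "finite J'" "J' \<subseteq> U"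
      using less.prems by (auto simp: psubset_card_mono finite_subset)
    then show ?thesis
      using less.hyps ripe_comps[OF R less.prems(3) that] by blast
  qed
  have card_J: "card J = card (J - K) + card K" if "K \<subseteq> J" for K
    using that less.prems(1) by (simp add: card_Diff_subset card_mono finite_subset)
  \<comment> \<open>Deleting the exposed \<open>v\<close> exposes its neighbours in
    \<open>J\<close>, so only the rest of \<open>J\<close> has to be paid for.\<close>
  have nbrs: "covers R {v} X J m"
    if "v \<in> X" and m: "covers R {} (X \<union> {a\<in>J. R v a}) (J - {a\<in>J. R v a}) m" for v m
  proof -
    let ?K = "{a\<in>J. R v a}"
    obtain W where W: "finite W" "2 * card W \<le> m" "J - ?K \<subseteq> exposed R (X \<union> ?K) W"
      using m unfolding covers_def by auto
    have K: "X \<union> ?K \<subseteq> exposed R X ({v} \<union> W)"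
      using \<open>v \<in> X\<close> by (auto intro: exposed.intros)
    then have "J - ?K \<subseteq> exposed R X ({v} \<union> W)"
      using W(3) exposed_trans[OF _ K] by blast
    then show ?thesis
      using W K unfolding covers_def by blast
  qed
  \<comment> \<open>The components exceed their size by at most 1 per neighbour of \<open>v\<close>.
    The neighbours themselves come for free, so the total is \<open>card J\<close>.\<close>
  have D: "covers R {v} X J (card J)" if v: "v \<in> X" "\<exists>a\<in>J. R v a" for v
  proof -
    let ?K = "{a\<in>J. R v a}"
    have "covers R {} (X \<union> ?K) (\<Union>(comps R (J - ?K))) (sum card (comps R (J - ?K)) + card ?K)"
      using less.prems(1) v sub[of _ ?K] by (intro covers_stars finite_comps) auto
    then have "covers R {} (X \<union> ?K) (J - ?K) (card J)"
      using R less.prems(1) card_J[of ?K] by (simp add: Union_comps sum_card_comps)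
    then show ?thesis by (rule nbrs[OF v(1)])
  qed
  moreover have "covers R {} X J (card J + 1)"
  proof (cases "odd (card J)")
    case True
    obtain v where "v \<in> X" "\<exists>a\<in>J. R v a"
      using J(2) by blast
    then have "covers R {} X J (card J + 2)"
      by (intro covers_delete[of R v] D)
    then show ?thesis
      using covers_parity[of R "{}" X J "card J + 2"] True by simp
  next
    case even: False
    have "J \<noteq> {}" using J(1) by (simp add: conn_def)
    then have "card J \<noteq> 0" "card J \<noteq> 1" using even less.prems(1) by auto
    then have "2 \<le> card J" by linarith
    then obtain v a b where v: "v \<notin> J" and ab: "a \<in> J" "b \<in> J" "a \<noteq> b" "R v a" "R v b"
      using two[OF less.prems(2) J(1)] by blast
    then have "v \<in> X" by (rule J_two)
    define K where "K = {a\<in>J. R v a}"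
    have K: "K \<subseteq> J" "K \<noteq> {}" "finite K" "a \<in> K" "b \<in> K"
      using ab less.prems(1) by (auto simp: K_def)
    define \<J> where "\<J> = comps R (J - K)"
    have \<J>: "finite \<J>" "\<Union>\<J> = J - K" "sum card \<J> = card (J - K)"
      using R less.prems(1) by (auto simp: \<J>_def finite_comps Union_comps sum_card_comps)
    have cheap: "cheap R (X \<union> K) J'" "\<exists>c\<in>K. \<exists>a\<in>J'. R c a" if "J' \<in> \<J>" for J'
      using sub[of J' K] that K by (auto simp: \<J>_def)
    show ?thesis
    proof (cases "covers R {} (X \<union> K) (J - K) (card J - 1)")
      case True
      then have "covers R {} X J (card J - 1 + 2)"
        by (intro covers_delete[of R v] nbrs[OF \<open>v \<in> X\<close>, folded K_def])
      then show ?thesis using \<open>card J \<noteq> 0\<close> by simp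
    next
      case False
      \<comment> \<open>Otherwise \<open>covers_stars_strict\<close> would save 1 and the deletion
        of \<open>v\<close> would be affordable. This is used with all components attached to
        \<open>c\<close>, and then with \<open>j c\<close> left out.\<close>
      have strict: "card {J\<in>\<S>. odd (card J)} = 1"
        if "c \<in> K" "\<S> \<subseteq> \<J>" "\<And>J. J \<in> \<S> \<Longrightarrow> \<exists>a\<in>J. R c a"
          "\<And>J. J \<in> \<J> - \<S> \<Longrightarrow> \<exists>d\<in>K - {c}. \<exists>a\<in>J. R d a" for c \<S>
      proof (rule ccontr)
        assume "card {J\<in>\<S>. odd (card J)} \<noteq> 1"
        then have "covers R {} (X \<union> K) (\<Union>\<J>) (sum card \<J> + card K - 1)"
          using that K \<J> cheap by (intro covers_stars_strict[of K \<J> _ c R \<S>]) auto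
        then show False
          using False \<J> card_J[OF K(1)] by simp
      qed
      have "\<exists>I. {J\<in>\<J>. (\<exists>a\<in>J. R c a) \<and> odd (card J)} = {I}" if "c \<in> K" for c
      proof -
        have "card {J\<in>{J\<in>\<J>. \<exists>a\<in>J. R c a}. odd (card J)} = 1"
        proof (rule strict[OF that])
          fix J assume "J \<in> \<J> - {J\<in>\<J>. \<exists>a\<in>J. R c a}"
          then show "\<exists>d\<in>K - {c}. \<exists>a\<in>J. R d a"
            using cheap(2)[of J] by auto
        qed auto
        then show ?thesis by (simp add: card_1_singleton_iff)
      qed
      then have "\<forall>c\<in>K. \<exists>I. {J\<in>\<J>. (\<exists>a\<in>J. R c a) \<and> odd (card J)} = {I}" by blast
      from bchoice[OF this] obtain j
        where "\<forall>c\<in>K. {J\<in>\<J>. (\<exists>a\<in>J. R c a) \<and> odd (card J)} = {j c}" ..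
      then have j: "I \<in> \<J> \<and> (\<exists>a\<in>I. R c a) \<and> odd (card I) \<longleftrightarrow> I = j c" if "c \<in> K" for c I
        using that by (simp add: set_eq_iff)
      then have jJ: "j c \<in> \<J>" "odd (card (j c))" "\<exists>a\<in>j c. R c a" if "c \<in> K" for c
        using j[OF that, of "j c"] by simp_all
      \<comment> \<open>If \<open>j c\<close> were also attached to \<open>d\<close>, it could be
        left to \<open>d\<close>, and the star at \<open>c\<close> would keep no odd
        component.\<close>
      have only: "d = c" if cd: "c \<in> K" "d \<in> K" "\<exists>a\<in>j c. R d a" for c d
      proof (rule ccontr)
        assume "d \<noteq> c"
        let ?S = "{J\<in>\<J>. \<exists>a\<in>J. R c a} - {j c}"
        have "card {J\<in>?S. odd (card J)} = 1"
        proof (rule strict[OF cd(1)])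
          fix J assume "J \<in> \<J> - ?S"
          then show "\<exists>d\<in>K - {c}. \<exists>a\<in>J. R d a"
            using cheap(2)[of J] cd \<open>d \<noteq> c\<close> by auto
        qed auto
        moreover have "{J\<in>?S. odd (card J)} = {}"
          using j[OF cd(1)] by auto
        ultimately show False by (metis card.empty zero_neq_one)
      qed
      define \<B> where "\<B> = (\<lambda>c. insert c (j c)) ` K"
      define \<E> where "\<E> = {J\<in>\<J>. even (card J)}"
      have jsub: "j c \<subseteq> J - K" if "c \<in> K" for c
        using jJ(1)[OF that] \<J>(2) by blast
      have B: "covers R {} X (insert c (j c)) (card (insert c (j c)))" if c: "c \<in> K" for c
      proof -
        \<comment> \<open>A second neighbour \<open>d\<close> of \<open>v\<close> makes the set a
          proper subset of \<open>J\<close>, so that induction applies.\<close>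
        obtain d where d: "d \<in> K" "d \<noteq> c" using K ab(3) by blast
        have "insert c (j c) \<subset> J" using c d jsub K(1) by blast
        then have small: "card (insert c (j c)) < card J" "finite (insert c (j c))" "insert c (j c) \<subseteq> U"
          using less.prems by (auto simp: psubset_card_mono intro: finite_subset)
        have conn_j: "conn R (j c)"
          using jJ(1)[OF c] conn_comps[OF R] unfolding \<J>_def by blast
        have "conn R (insert c (j c))"
          unfolding conn_def
        proof (intro conjI allI impI)
          fix A assume A: "A \<subseteq> insert c (j c)" "A \<noteq> {}" "A \<noteq> insert c (j c)"
          show "\<exists>a\<in>A. \<exists>b\<in>insert c (j c) - A. R a b"
          proof (cases "A \<inter> j c = {} \<or> A \<inter> j c = j c")
            case True
            have "c \<notin> j c" using jsub c by blast
            then have "A = {c} \<or> A = j c" using True A by blast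
            then show ?thesis
              using jJ(3)[OF c] R \<open>c \<notin> j c\<close> by (auto dest: sympD)
          next
            case False
            then show ?thesis
              using conn_j A unfolding conn_def by (smt (verit) Diff_iff IntD1 Int_iff Int_lower2 insert_iff)
          qed
        qed simp
        moreover have "u \<in> X"
          if u: "u \<notin> insert c (j c)" "a \<in> insert c (j c)" "b \<in> insert c (j c)" "a \<noteq> b" "R u a" "R u b" for u a b
        proof (rule ccontr)
          assume "u \<notin> X"
          then have "u \<in> J"
            using J_two[of u a b] u \<open>insert c (j c) \<subset> J\<close> by blast
          \<comment> \<open>One of the two neighbours lies in \<open>j c\<close>. As
            \<open>u\<close> is in \<open>J\<close> but not in \<open>j c\<close>, it lies in
            \<open>K\<close>, and then \<open>only\<close> forces \<open>u = c\<close>.\<close>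
          obtain a' where a': "a' \<in> j c" "R u a'" using u by blast
          then have "u \<in> K"
            using comps_closed[of "j c" R "J - K" a' u] jJ(1)[OF c] \<open>u \<in> J\<close> u R
            unfolding \<J>_def by (auto dest: sympD)
          then show False using only[OF c] a' u(1) by blast
        qed
        moreover have "R v c" using c by (simp add: K_def)
        ultimately have "ripe R X (insert c (j c))"
          using \<open>v \<in> X\<close> unfolding ripe_def by blast
        then have "cheap R X (insert c (j c))"
          using less.hyps small by blast
        moreover have "even (card (insert c (j c)))"
          using jJ(2)[OF c] jsub[OF c] c small(2) by (subst card_insert_disjoint) auto
        ultimately show ?thesis
          using covers_parity[of R "{}" X "insert c (j c)" "card (insert c (j c)) + 1"]
          by (simp add: cheap_def)
      qed
      have E: "covers R {} (X \<union> K) J' (card J')" if "J' \<in> \<E>" for J'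
        using that cheap(1)[of J'] covers_parity[of R "{}" "X \<union> K" J' "card J' + 1"]
        by (auto simp: \<E>_def cheap_def)
      have "covers R {} X (\<Union>\<B>) (sum card \<B>)"
        using K(3) B by (intro covers_Union) (auto simp: \<B>_def)
      moreover have "covers R {} (X \<union> \<Union>\<B>) (\<Union>\<E>) (sum card \<E>)"
      proof (rule covers_Union)
        show "covers R {} (X \<union> \<Union>\<B>) J' (card J')" if "J' \<in> \<E>" for J'
          by (rule covers_mono[OF E[OF that]]) (auto simp: \<B>_def)
      qed (use \<J>(1) in \<open>simp add: \<E>_def\<close>)
      ultimately have "covers R {} X (\<Union>\<B> \<union> \<Union>\<E>) (sum card \<B> + sum card \<E>)"
        by (rule covers_Un)
      moreover have JBE: "\<Union>\<B> \<union> \<Union>\<E> = J"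
      proof
        show "\<Union>\<B> \<union> \<Union>\<E> \<subseteq> J"
          using jsub K(1) \<J>(2) by (auto simp: \<B>_def \<E>_def)
        show "J \<subseteq> \<Union>\<B> \<union> \<Union>\<E>"
        proof
          fix x assume x: "x \<in> J"
          show "x \<in> \<Union>\<B> \<union> \<Union>\<E>"
          proof (cases "x \<in> K")
            case True
            then show ?thesis by (auto simp: \<B>_def)
          next
            case False
            then obtain I where I: "I \<in> \<J>" "x \<in> I" using x \<J>(2) by blast
            show ?thesis
            proof (cases "even (card I)")
              case True
              then show ?thesis using I by (auto simp: \<E>_def)
            next
              case False
              obtain c where "c \<in> K" "\<exists>a\<in>I. R c a" using cheap(2)[OF I(1)] by blast
              then have "I = j c" using j False I(1) by blast
              then show ?thesis using \<open>c \<in> K\<close> I(2) by (auto simp: \<B>_def)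
            qed
          qed
        qed
      qed
      moreover have "sum card \<B> + sum card \<E> \<le> card J"
      proof -
        \<comment> \<open>The \<open>j c\<close> are distinct for distinct \<open>c\<close> and
          differ from the even components by parity. So together they count at most
          \<open>card (J - K)\<close>, and the vertices \<open>c\<close> add
          \<open>card K\<close>.\<close>
        have "inj_on j K" using only jJ(3) by (metis inj_onI)
        have "sum card \<B> \<le> (\<Sum>c\<in>K. card (insert c (j c)))"
          unfolding \<B>_def using sum_image_le[OF K(3), of card "\<lambda>c. insert c (j c)"] by (simp add: comp_def)
        also have "\<dots> \<le> (\<Sum>c\<in>K. card (j c) + 1)"
          by (intro sum_mono) (simp add: card_insert_le_m1 card_insert_if)
        also have "\<dots> = sum card (j ` K) + card K"
          using \<open>inj_on j K\<close> by (subst sum.reindex) (simp_all add: sum.distrib sum_Suc)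
        finally have "sum card \<B> + sum card \<E> \<le> card K + (sum card (j ` K) + sum card \<E>)"
          by simp
        also have "sum card (j ` K) + sum card \<E> = sum card (j ` K \<union> \<E>)"
          using K(3) \<J>(1) jJ(2) by (intro sum.union_disjoint[symmetric]) (auto simp: \<E>_def)
        also have "\<dots> \<le> sum card \<J>"
          using \<J>(1) jJ(1) by (intro sum_mono2) (auto simp: \<E>_def)
        finally show ?thesis using \<J>(3) card_J[OF K(1)] by simp
      qed
      ultimately show ?thesis
        by (auto intro: covers_mono)
    qed
  qed
  ultimately show ?case unfolding cheap_def by blast
qed

text \<open>Unless everything is exposed, \<open>V\<close> itself is ripe, as no vertex outside
  \<open>V\<close> has neighbours. Hence the components of \<open>V - X\<close> are ripe, cheap and
  attached to \<open>X\<close>. Their total excess is at most \<open>card X\<close>, which adds up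
  to \<open>card V\<close>.\<close>

lemma half_exposing_set:
  assumes "symp R" "finite V" "X \<subseteq> V" "X \<noteq> {}" "conn R V" "\<And>u v. R u v \<Longrightarrow> u \<in> V"
    and two: "\<And>J. J \<subseteq> V \<Longrightarrow> J \<noteq> V \<Longrightarrow> conn R J \<Longrightarrow> 2 \<le> card J \<Longrightarrow>
      \<exists>v. v \<notin> J \<and> (\<exists>a\<in>J. \<exists>b\<in>J. a \<noteq> b \<and> R v a \<and> R v b)"
  obtains W where "finite W" "2 * card W \<le> card V" "V \<subseteq> exposed R X W"
proof -
  let ?\<J> = "comps R (V - X)"
  have *: "cheap R X J \<and> (\<exists>c\<in>X. \<exists>a\<in>J. R c a)" if J: "J \<in> ?\<J>" for J
  proof -
    have sub: "J \<subseteq> V - X" "J \<noteq> {}"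
      using comps_subset[OF J] conn_comps[OF assms(1) J] by (auto simp: conn_def)
    then have "X \<noteq> V" by blast
    then have "\<exists>x\<in>X. \<exists>a\<in>V. R x a"
      using assms(3-5) unfolding conn_def by blast
    then have "ripe R X V"
      using assms(5,6) unfolding ripe_def by blast
    then have "ripe R X J" "\<exists>c\<in>X. \<exists>a\<in>J. R c a"
      using ripe_comps[OF assms(1) _ J assms(3,4), of X] by auto
    moreover have "cheap R X J"
    proof (rule ripe_cheap[OF assms(1) _ _ sub(1) \<open>ripe R X J\<close>])
      fix J assume J: "J \<subseteq> V - X" "conn R J" "2 \<le> card J"
      then have "J \<subseteq> V" "J \<noteq> V" using assms(3,4) by auto
      then show "\<exists>v. v \<notin> J \<and> (\<exists>a\<in>J. \<exists>b\<in>J. a \<noteq> b \<and> R v a \<and> R v b)"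
        using J(2,3) by (rule two)
    qed (use assms(2) sub(1) finite_subset in blast)
    ultimately show ?thesis by blast
  qed
  have "covers R {} X (\<Union>?\<J>) (sum card ?\<J> + card X)"
    using assms(2,3) * by (intro covers_stars finite_comps) (auto intro: finite_subset)
  moreover have "sum card ?\<J> + card X = card V"
    using assms(1-3) by (simp add: sum_card_comps card_Diff_subset card_mono finite_subset)
  ultimately obtain W where W: "finite W" "2 * card W \<le> card V" "V - X \<subseteq> exposed R X W"
    unfolding covers_def Union_comps by auto
  then have "V \<subseteq> exposed R X W"
    by (auto intro: exposed.start)
  with W show ?thesis using that by blast
qed

section \<open>Arcs in the plane\<close>

text \<open>A disc stays connected when a point is removed, an interval does not when an inner point
  is. So among three parameters of points of a disc, the middle one could not be left out.\<close>

lemma interior_arc_image_empty: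
  fixes g :: "real \<Rightarrow> complex"
  assumes "arc g"
  shows "interior (path_image g) = {}"
proof (rule ccontr)
  assume "interior (path_image g) \<noteq> {}"
  then obtain z e where e: "0 < e" "ball z e \<subseteq> path_image g"
    by (meson ex_in_conv mem_interior)
  let ?B = "ball z e"
  obtain h where h: "homeomorphism {0..1} (path_image g) g h"
    using assms homeomorphism_arc by blast
  then have "inj_on h ?B" "continuous_on ?B h"
    using e(2) by (auto simp: homeomorphism_def inj_on_def subset_iff intro: continuous_on_subset) metis
  have "infinite ?B" using e(1) uncountable_ball[of e z] countable_finite by blast
  then have "infinite (h ` ?B)" using \<open>inj_on h ?B\<close> finite_imageD by blast
  then obtain S where S: "S \<subseteq> h ` ?B" "card S = 3" "finite S"
    using infinite_arbitrarily_large by blast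
  then obtain u v w where uvw: "u < v" "v < w" "{u, v, w} \<subseteq> h ` ?B"
  proof -
    define l where "l = sorted_list_of_set S"
    have "length l = 3" "sorted_wrt (<) l" "set l = S"
      using S by (auto simp: l_def)
    then have "l ! 0 < l ! 1" "l ! 1 < l ! 2" "{l ! 0, l ! 1, l ! 2} \<subseteq> S"
      by (auto simp: sorted_wrt_iff_nth_less)
    then show ?thesis using that S(1) by blast
  qed
  then obtain x y y' where xy: "x \<in> ?B" "h x = v" "y \<in> ?B" "h y = u" "y' \<in> ?B" "h y' = w"
    by auto
  have "connected (?B - {x})"
    by (simp add: connected_open_delete)
  then have "connected (h ` (?B - {x}))"
    using \<open>continuous_on ?B h\<close> by (meson Diff_subset connected_continuous_image continuous_on_subset)
  moreover have "u \<in> h ` (?B - {x})" "w \<in> h ` (?B - {x})"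
    using xy uvw by force+
  ultimately have "v \<in> h ` (?B - {x})"
    using uvw by (meson connected_contains_Icc atLeastAtMost_iff less_imp_le subsetD)
  then show False
    using \<open>inj_on h ?B\<close> xy by (auto simp: inj_on_def)
qed

text \<open>If some \<open>g t\<close> with \<open>t > s\<close> were outside \<open>closure A\<close>, then a small open piece of the arc
  could be removed without changing \<open>A\<close>. What is left of the arc on the side of \<open>s\<close> is
  attached at one end only, so by Janiszewski's theorem it separates nothing and \<open>A\<close> reaches
  its free end.\<close>

lemma arc_meets_closure_forward:
  fixes g :: "real \<Rightarrow> complex"
  assumes g: "arc g" and K: "closed K" "path_image g \<inter> K = {pathstart g, pathfinish g}"
    and A: "A \<inter> (K \<union> path_image g) = {}" "frontier A \<subseteq> K \<union> path_image g"
    and s: "0 < s" "s < t" "t < 1" "g s \<in> closure A"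
  shows "g t \<in> closure A"
proof (rule ccontr)
  assume t: "g t \<notin> closure A"
  have contg: "continuous_on {0..1} g" and inj: "inj_on g {0..1}"
    using g by (auto simp: arc_def path_def)
  have image: "g x \<in> path_image g" if "x \<in> {0..1}" for x
    using that by (auto simp: path_image_def)
  \<comment> \<open>Halfway between \<open>t\<close> and the last parameter in \<open>{s..t}\<close>
    whose point lies in the closure of \<open>A\<close>.\<close>
  obtain r where r: "s < r" "r < t" "g ` {r..t} \<inter> closure A = {}"
  proof -
    define M where "M = {x\<in>{s..t}. g x \<in> closure A}"
    have "closed M"
      using continuous_closed_preimage[of "{s..t}" g "closure A"] continuous_on_subset[OF contg, of "{s..t}"] s
      by (auto simp: M_def vimage_def Int_def)
    moreover have M: "M \<noteq> {}" "bdd_above M"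
      using s by (auto simp: M_def intro!: exI[of _ s] bdd_aboveI[of _ t])
    ultimately have "Sup M \<in> M" by (intro closed_contains_Sup)
    have upper: "x \<le> Sup M" if "x \<in> M" for x
      using M(2) that by (intro cSup_upper)
    have "Sup M \<noteq> t" using t \<open>Sup M \<in> M\<close> by (auto simp: M_def)
    then have "s \<le> Sup M" "Sup M < t" using \<open>Sup M \<in> M\<close> by (auto simp: M_def)
    moreover have "g x \<notin> closure A" if "(Sup M + t) / 2 \<le> x" "x \<le> t" for x
      using upper[of x] that calculation by (force simp: M_def)
    ultimately show ?thesis
      using that[of "(Sup M + t) / 2"] by force
  qed
  \<comment> \<open>The open piece between \<open>r\<close> and \<open>t\<close> is left out, so
    that \<open>\<alpha>\<close> and \<open>L\<close> meet only in \<open>g 0\<close>.\<close>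
  define \<alpha> where "\<alpha> = g ` {0..r}"
  define L where "L = K \<union> g ` {t..1}"
  have arc\<alpha>: "arc (subpath 0 r g)" "path_image (subpath 0 r g) = \<alpha>"
    using g r s by (auto simp: \<alpha>_def path_image_subpath intro!: arc_subpath_arc)
  have "compact \<alpha>" "connected (- \<alpha>)" "interior \<alpha> = {}"
    using arc\<alpha> compact_arc_image[of "subpath 0 r g"] connected_arc_complement[of "subpath 0 r g"]
      interior_arc_image_empty[of "subpath 0 r g"] by auto
  have "compact (g ` {t..1})"
    using contg s by (intro compact_continuous_image) (auto intro: continuous_on_subset)
  then have "closed L" using K(1) by (simp add: L_def closed_Un compact_imp_closed)
  have eq: "x = y" if "g x = g y" "x \<in> {0..1}" "y \<in> {0..1}" for x y
    using inj that by (auto simp: inj_on_def)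
  have notK: "g x \<notin> K" if "0 < x" "x < 1" for x
  proof
    assume "g x \<in> K"
    then have "g x = g 0 \<or> g x = g 1"
      using K(2) image[of x] that by (auto simp: pathstart_def pathfinish_def)
    then show False using eq[of x 0] eq[of x 1] that by auto
  qed
  have notL: "g x \<notin> L" if "0 < x" "x < t" for x
    using notK[of x] that s by (auto simp: L_def dest!: eq)
  have "g 0 \<in> K" using K(2) by (auto simp: pathstart_def)
  have "\<alpha> \<inter> L = {g 0}"
  proof -
    have "g x = g 0" if "x \<in> {0..r}" "g x \<in> L" for x
      using notL[of x] that r by (cases "x = 0") auto
    moreover have "g 0 \<in> \<alpha> \<inter> L"
      using \<open>g 0 \<in> K\<close> r s by (auto simp: \<alpha>_def L_def)
    ultimately show ?thesis unfolding \<alpha>_def by blast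
  qed
  have \<alpha>L: "(K \<union> path_image g) - (\<alpha> \<union> L) \<subseteq> g ` {r..t}" "\<alpha> \<union> L \<subseteq> K \<union> path_image g"
    using r s by (auto simp: \<alpha>_def L_def path_image_def image_iff)
      (metis atLeastAtMost_iff linear)
  have "open (- L)" using \<open>closed L\<close> by (rule open_Compl)
  then obtain d e where d: "0 < d" "ball (g s) d \<subseteq> - L" and e: "0 < e" "ball (g r) e \<subseteq> - L"
    using notL[of s] notL[of r] r s by (meson Compl_iff openE order.strict_trans)
  obtain x where x: "x \<in> A" "x \<in> ball (g s) d"
    using s(4) d(1) by (auto simp: closure_approachable dist_commute)
  have "x \<notin> \<alpha>" using x(1) A(1) \<alpha>L(2) by blast
  \<comment> \<open>Two discs and the arc between them join \<open>x\<close> to \<open>y\<close>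
    outside \<open>L\<close>, and the arc \<open>\<alpha>\<close> does not separate the plane. The
    set \<open>C\<close> from Janiszewski's theorem can meet the frontier of \<open>A\<close> only
    in the omitted piece, which misses the closure of \<open>A\<close>.\<close>
  have inA: "y \<in> A" if y: "y \<in> ball (g r) e" "y \<notin> \<alpha>" for y
  proof -
    have "connected (g ` {s..r})"
      using contg r s by (intro connected_continuous_image) (auto intro: continuous_on_subset)
    moreover have "g s \<in> ball (g s) d \<inter> g ` {s..r}" "g r \<in> g ` {s..r} \<inter> ball (g r) e"
      using d(1) e(1) r by auto
    ultimately have "connected (ball (g s) d \<union> g ` {s..r} \<union> ball (g r) e)"
      by (intro connected_Un connected_ball) blast+
    moreover have "g ` {s..r} \<subseteq> - L" using notL r s by auto
    ultimately have "connected_component (- L) x y"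
      using d e x y unfolding connected_component_def
      by (intro exI[of _ "ball (g s) d \<union> g ` {s..r} \<union> ball (g r) e"]) auto
    moreover have "connected_component (- \<alpha>) x y"
      using \<open>connected (- \<alpha>)\<close> \<open>x \<notin> \<alpha>\<close> y(2) by (auto simp: connected_iff_connected_component)
    ultimately have "connected_component (- (\<alpha> \<union> L)) x y"
      using \<open>compact \<alpha>\<close> \<open>closed L\<close> \<open>\<alpha> \<inter> L = {g 0}\<close> by (intro Janiszewski) auto
    then obtain C where C: "connected C" "C \<subseteq> - (\<alpha> \<union> L)" "x \<in> C" "y \<in> C"
      unfolding connected_component_def by blast
    have "C \<inter> frontier A = {}"
      using C(2) A(2) \<alpha>L(1) r(3) Diff_subset[of "closure A" "interior A"]
      unfolding frontier_def by blast
    then show ?thesis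
      using connected_Int_frontier[OF C(1), of A] C x by blast
  qed
  have "g r \<in> closure A"
    unfolding closure_approachable
  proof (intro allI impI)
    fix \<epsilon> :: real assume "0 < \<epsilon>"
    then have "\<not> ball (g r) (min \<epsilon> e) \<subseteq> \<alpha>"
      using \<open>interior \<alpha> = {}\<close> e(1) by (metis emptyE mem_interior min_less_iff_conj)
    then obtain y where "y \<in> ball (g r) (min \<epsilon> e)" "y \<notin> \<alpha>" by blast
    then show "\<exists>y\<in>A. dist y (g r) < \<epsilon>"
      using inA[of y] by (auto simp: dist_commute)
  qed
  moreover have "g r \<in> g ` {r..t}" using r by auto
  ultimately show False using r(3) by blast
qed

text \<open>Parameters after \<open>s\<close> are reached along \<open>g\<close>, those before
  \<open>s\<close> along the reversed arc, and the ends by continuity.\<close>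

lemma arc_subset_closure:
  fixes g :: "real \<Rightarrow> complex"
  assumes g: "arc g" and K: "closed K" "path_image g \<inter> K = {pathstart g, pathfinish g}"
    and A: "A \<inter> (K \<union> path_image g) = {}" "frontier A \<subseteq> K \<union> path_image g"
    and p: "p \<in> path_image g" "p \<notin> K" "p \<in> closure A"
  shows "path_image g \<subseteq> closure A"
proof -
  obtain s where s: "p = g s" "0 \<le> s" "s \<le> 1" using p(1) by (auto simp: path_image_def)
  moreover have "s \<noteq> 0" "s \<noteq> 1"
    using s K(2) p(2) by (auto simp: pathstart_def pathfinish_def)
  ultimately have s: "p = g s" "0 < s" "s < 1" by auto
  have "g t \<in> closure A" if t: "0 < t" "t < 1" for t
  proof (cases "s < t")
    case True
    then show ?thesis
      using arc_meets_closure_forward[OF g K A] s p(3) t by blast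
  next
    case False
    let ?g = "reversepath g"
    have "?g (1 - t) \<in> closure A" if "t \<noteq> s"
    proof (rule arc_meets_closure_forward[of ?g K A "1 - s"])
      show "path_image ?g \<inter> K = {pathstart ?g, pathfinish ?g}"
        using K(2) by auto
    qed (use False that assms s t in \<open>auto simp: arc_reversepath\<close>, simp add: reversepath_def)
    then show ?thesis
      using s p(3) by (cases "t = s") (auto simp: reversepath_def)
  qed
  then have "g ` {0<..<1} \<subseteq> closure A" by auto
  moreover have "continuous_on (closure {0<..<1}) g"
    using g by (simp add: arc_def path_def)
  ultimately have "g ` closure {0<..<1} \<subseteq> closure A"
    using image_closure_subset by blast
  then show ?thesis by (simp add: path_image_def)
qed

text \<open>Either the ends of the arc are joined inside \<open>K\<close>, and then the arc lies on a Jordan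
  curve whose two sides separate the new components, or \<open>K\<close> splits into two closed parts
  and the arc is a bridge between them, which separates nothing.\<close>

lemma finite_components_add_arc:
  fixes g :: "real \<Rightarrow> complex"
  assumes \<P>: "finite \<P>" "\<And>P. P \<in> \<P> \<Longrightarrow> compact P \<and> path_connected P"
    and g: "arc g" "path_image g \<inter> \<Union>\<P> = {pathstart g, pathfinish g}"
    and fin: "finite (components (- \<Union>\<P>))"
  shows "finite (components (- (\<Union>\<P> \<union> path_image g)))"
proof -
  define K where "K = \<Union>\<P>"
  define a b where "a = pathstart g" and "b = pathfinish g"
  have "a \<noteq> b" "a \<in> K" "b \<in> K" and gK: "path_image g \<inter> K = {a, b}"
    using g arc_distinct_ends[OF g(1)] by (auto simp: a_def b_def K_def)
  have "compact K" using \<P> by (auto simp: K_def)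
  \<comment> \<open>With the old component, a label with two values determines the new component, so
    the number of components at most doubles.\<close>
  have "\<exists>side :: complex \<Rightarrow> bool. \<forall>x y. x \<notin> K \<union> path_image g \<longrightarrow> y \<notin> K \<union> path_image g \<longrightarrow>
      connected_component (- K) x y \<longrightarrow> side x = side y \<longrightarrow>
      connected_component (- (K \<union> path_image g)) x y"
  proof (cases "path_component K b a")
    case True
    then obtain p where "path p" "path_image p \<subseteq> K" "pathstart p = b" "pathfinish p = a"
      unfolding path_component_def by blast
    then obtain q where q: "arc q" "path_image q \<subseteq> K" "pathstart q = b" "pathfinish q = a"
      using path_contains_arc[of p b a] \<open>a \<noteq> b\<close> by (metis subset_trans)
    let ?c = "g +++ q"
    have ends: "pathfinish g = pathstart q" "pathfinish q = pathstart g"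
      using q by (auto simp: a_def b_def)
    have image: "path_image ?c = path_image g \<union> path_image q"
      using ends by (simp add: path_image_join)
    have ab: "{a, b} \<subseteq> path_image q"
      using q pathstart_in_path_image[of q] pathfinish_in_path_image[of q] by auto
    have "simple_path ?c"
      using g(1) q ends gK by (intro simple_path_join_loop) (auto simp: a_def b_def)
    moreover have "pathfinish ?c = pathstart ?c" using ends by simp
    ultimately have sides: "connected (inside (path_image ?c))" "connected (outside (path_image ?c))"
        "closed (path_image ?c)"
      using Jordan_inside_outside[of ?c] closed_simple_path_image by blast+
    have "K \<inter> path_image ?c = path_image q"
      using image q(2) gK ab by blast
    then have conn: "connected (K \<inter> path_image ?c)"
      using q(1) by (simp add: connected_arc_image)
    have "connected_component (- (K \<union> path_image g)) x y"
      if xy: "x \<notin> K \<union> path_image g" "y \<notin> K \<union> path_image g" "connected_component (- K) x y"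
        and side: "x \<in> inside (path_image ?c) \<longleftrightarrow> y \<in> inside (path_image ?c)" for x y
    proof -
      have "x \<in> - path_image ?c" "y \<in> - path_image ?c" using xy(1,2) image q(2) by auto
      then have "{x, y} \<subseteq> inside (path_image ?c) \<or> {x, y} \<subseteq> outside (path_image ?c)"
        using side inside_Un_outside[of "path_image ?c"] by blast
      then have "connected_component (- path_image ?c) x y"
        unfolding connected_component_def
        using sides inside_Un_outside[of "path_image ?c"] by (metis insert_subset sup_ge1 sup_ge2)
      then have "connected_component (- (K \<union> path_image ?c)) x y"
        using \<open>compact K\<close> sides(3) conn xy(3) by (intro Janiszewski)
      moreover have "K \<union> path_image ?c = K \<union> path_image g" using image q(2) by blast
      ultimately show ?thesis by simp
    qed
    then show ?thesis by (intro exI[of _ "\<lambda>x. x \<in> inside (path_image ?c)"]) blast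
  next
    case False
    define Ka where "Ka = \<Union>{P\<in>\<P>. P \<subseteq> path_component_set K a}"
    define Kb where "Kb = \<Union>{P\<in>\<P>. \<not> P \<subseteq> path_component_set K a}"
    have K: "K = Ka \<union> Kb" by (auto simp: K_def Ka_def Kb_def)
    have comp: "P \<subseteq> path_component_set K a" if "P \<in> \<P>" "x \<in> P" "path_component K a x" for P x
    proof -
      have "P \<subseteq> path_component_set K x"
        using that \<P>(2) by (intro path_component_maximal) (auto simp: K_def)
      then show ?thesis using that(3) path_component_eq by blast
    qed
    have "Ka \<inter> Kb = {}"
      using comp unfolding Ka_def Kb_def by blast
    moreover have "a \<in> Ka"
      using comp[of _ a] \<open>a \<in> K\<close> by (auto simp: Ka_def K_def path_component_refl)
    moreover have "b \<notin> Ka"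
      using False unfolding Ka_def by (auto intro: path_component_sym)
    ultimately have ab: "path_image g \<inter> Ka = {a}" "(Ka \<union> path_image g) \<inter> Kb = {b}"
      using K gK \<open>b \<in> K\<close> by auto
    have cpt: "compact Ka" "compact Kb" "compact (path_image g)"
      using \<P> g(1) by (auto simp: Ka_def Kb_def compact_arc_image)
    have "connected_component (- (K \<union> path_image g)) x y"
      if xy: "x \<notin> K \<union> path_image g" "y \<notin> K \<union> path_image g" "connected_component (- K) x y" for x y
    proof -
      have "connected_component (- Ka) x y" "connected_component (- Kb) x y"
        using xy(3) K by (auto intro: connected_component_of_subset)
      moreover have "connected_component (- path_image g) x y"
        using connected_arc_complement[OF g(1)] xy(1,2)
        by (auto simp: connected_iff_connected_component)
      \<comment> \<open>Janiszewski's theorem is used twice, the intersections being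
        \<open>{b}\<close> and \<open>{a}\<close>.\<close>
      ultimately have "connected_component (- (path_image g \<union> Ka \<union> Kb)) x y"
        using cpt ab by (intro Janiszewski) (auto intro: compact_imp_closed simp: Un_commute)
      then show ?thesis by (simp add: K ac_simps)
    qed
    then show ?thesis by blast
  qed
  then obtain side :: "complex \<Rightarrow> bool" where side: "\<And>x y. \<lbrakk>x \<notin> K \<union> path_image g; y \<notin> K \<union> path_image g;
      connected_component (- K) x y; side x = side y\<rbrakk> \<Longrightarrow>
      connected_component (- (K \<union> path_image g)) x y"
    by metis
  let ?C = "components (- (K \<union> path_image g))"
  define pt where "pt F = (SOME x. x \<in> F)" for F :: "complex set"
  have pt: "pt F \<in> F" "pt F \<notin> K \<union> path_image g"
      "F = connected_component_set (- (K \<union> path_image g)) (pt F)" if "F \<in> ?C" for F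
  proof -
    show *: "pt F \<in> F"
      unfolding pt_def using in_components_nonempty[OF that] by (simp add: some_in_eq)
    show "pt F \<notin> K \<union> path_image g"
      using in_components_subset[OF that] * by blast
    show "F = connected_component_set (- (K \<union> path_image g)) (pt F)"
      using that * by (metis components_iff connected_component_eq)
  qed
  let ?f = "\<lambda>F. (connected_component_set (- K) (pt F), side (pt F))"
  have "inj_on ?f ?C"
  proof (rule inj_onI)
    fix F G assume FG: "F \<in> ?C" "G \<in> ?C" "?f F = ?f G"
    have "connected_component (- K) (pt F) (pt G)"
      using FG pt(2)[OF FG(1)] pt(2)[OF FG(2)] by (simp add: connected_component_eq_eq)
    then have "connected_component (- (K \<union> path_image g)) (pt F) (pt G)"
      using FG pt(2) by (intro side) auto
    then show "F = G"
      using pt(3)[OF FG(1)] pt(3)[OF FG(2)] connected_component_eq by (metis mem_Collect_eq)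
  qed
  moreover have "?f ` ?C \<subseteq> components (- K) \<times> UNIV"
    using pt(2) by (auto simp: components_def)
  moreover have "finite (components (- K) \<times> (UNIV :: bool set))"
    using fin by (simp add: K_def)
  ultimately have "finite ?C" by (meson finite_imageD finite_subset)
  then show ?thesis by (simp add: K_def)
qed

section \<open>Faces of a plane drawing\<close>

locale plane_graph =
  fixes V :: "'v set" and E :: "'v set set"
    and pos :: "'v \<Rightarrow> complex" and \<gamma> :: "'v set \<Rightarrow> real \<Rightarrow> complex"
  assumes plane: "plane_drawing V E pos \<gamma>"
begin

abbreviation points :: "complex set" where
  "points \<equiv> drawing_points V E pos \<gamma>"

abbreviation faces :: "complex set set" where
  "faces \<equiv> components (- points)"

definition on_face :: "'v \<Rightarrow> complex set \<Rightarrow> bool" where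
  "on_face v F \<longleftrightarrow> v \<in> V \<and> pos v \<in> closure F"

definition cofacial :: "'v \<Rightarrow> 'v \<Rightarrow> bool" where
  "cofacial u v \<longleftrightarrow> (\<exists>F\<in>faces. on_face u F \<and> on_face v F)"

lemma finite_V: "finite V" and edgeD: "e \<in> E \<Longrightarrow> e \<subseteq> V \<and> card e = 2"
  and inj_pos: "inj_on pos V"
  and arcD: "e \<in> E \<Longrightarrow> arc (\<gamma> e)"
  and ends: "e \<in> E \<Longrightarrow> {pathstart (\<gamma> e), pathfinish (\<gamma> e)} = pos ` e"
  and edge_vertices: "e \<in> E \<Longrightarrow> path_image (\<gamma> e) \<inter> pos ` V = pos ` e"
  and edges_meet: "e \<in> E \<Longrightarrow> f \<in> E \<Longrightarrow> e \<noteq> f \<Longrightarrow> path_image (\<gamma> e) \<inter> path_image (\<gamma> f) \<subseteq> pos ` (e \<inter> f)"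
  using plane by (simp_all add: plane_drawing_def simple_graph_def)

lemma edge_nonempty: "e \<in> E \<Longrightarrow> e \<noteq> {}"
  using edgeD[of e] by auto

lemma finite_E: "finite E"
proof (rule finite_subset)
  show "E \<subseteq> Pow V" using edgeD by blast
qed (simp add: finite_V)

lemma edge_meets_rest:
  assumes "e \<in> E" "E' \<subseteq> E" "e \<notin> E'"
  shows "path_image (\<gamma> e) \<inter> drawing_points V E' pos \<gamma> = {pathstart (\<gamma> e), pathfinish (\<gamma> e)}"
proof -
  have "path_image (\<gamma> e) \<inter> path_image (\<gamma> f) \<subseteq> pos ` e" if "f \<in> E'" for f
    using edges_meet[OF assms(1), of f] assms that by blast
  then have "path_image (\<gamma> e) \<inter> (\<Union>f\<in>E'. path_image (\<gamma> f)) \<subseteq> pos ` e" by blast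
  then show ?thesis
    unfolding drawing_points_def ends[OF assms(1)] Int_Un_distrib edge_vertices[OF assms(1)]
    by (rule Un_absorb2)
qed

section \<open>Topology of the drawing and its faces\<close>

lemma compact_points: "E' \<subseteq> E \<Longrightarrow> V' \<subseteq> V \<Longrightarrow> compact (drawing_points V' E' pos \<gamma>)"
  unfolding drawing_points_def
proof (rule compact_Un)
  assume *: "E' \<subseteq> E" "V' \<subseteq> V"
  show "compact (pos ` V')"
    using *(2) finite_V by (meson finite_imageI finite_imp_compact finite_subset)
  show "compact (\<Union>e\<in>E'. path_image (\<gamma> e))"
    using *(1) finite_E arcD by (intro compact_UN) (auto intro: finite_subset compact_arc_image)
qed

lemma closed_points: "closed points"
  by (intro compact_imp_closed compact_points subset_refl)

lemma interior_points: "interior points = {}"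
proof -
  have "interior (pos ` V \<union> (\<Union>e\<in>E'. path_image (\<gamma> e))) = {}" if "finite E'" "E' \<subseteq> E" for E'
    using that
  proof (induction rule: finite_induct)
    case empty
    then show ?case using finite_V by (simp add: empty_interior_finite)
  next
    case (insert e E')
    then have "interior (path_image (\<gamma> e) \<union> (pos ` V \<union> (\<Union>e\<in>E'. path_image (\<gamma> e)))) = {}"
      using arcD by (subst interior_closed_Un_empty_interior)
        (auto simp: interior_arc_image_empty closed_arc_image)
    then show ?case by (simp add: Un_left_commute)
  qed
  then show ?thesis using finite_E by (simp add: drawing_points_def)
qed

lemma connected_Compl_vertices: "connected (- pos ` V)"
  using connected_open_delete_finite[of UNIV "pos ` V"] finite_V connected_UNIV
  by (simp add: Compl_eq_Diff_UNIV)

text \<open>Add the edges one at a time to the vertices, whose complement is connected. Finiteness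
  is what makes unions of closures of faces closed.\<close>

lemma finite_faces: "finite faces"
proof -
  have "finite (components (- drawing_points V E' pos \<gamma>))" if "finite E'" "E' \<subseteq> E" for E'
    using that
  proof (induction rule: finite_induct)
    case empty
    have "components (- pos ` V) \<subseteq> {- pos ` V}"
      using connected_Compl_vertices components_eq_sing_iff[of "- pos ` V"]
      by (cases "- pos ` V = {}") auto
    then show ?case by (simp add: drawing_points_def finite_subset)
  next
    case (insert e E')
    define \<P> where "\<P> = (\<lambda>v. {pos v}) ` V \<union> (\<lambda>e. path_image (\<gamma> e)) ` E'"
    have \<P>: "\<Union>\<P> = drawing_points V E' pos \<gamma>"
      by (auto simp: \<P>_def drawing_points_def)
    have "finite (components (- (\<Union>\<P> \<union> path_image (\<gamma> e))))"
    proof (rule finite_components_add_arc)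
      show "finite \<P>" using finite_V insert by (simp add: \<P>_def)
      show "compact P \<and> path_connected P" if "P \<in> \<P>" for P
        using that arcD insert.prems
        by (auto simp: \<P>_def compact_arc_image arc_imp_path path_connected_path_image)
      show "path_image (\<gamma> e) \<inter> \<Union>\<P> = {pathstart (\<gamma> e), pathfinish (\<gamma> e)}"
        unfolding \<P> using insert by (intro edge_meets_rest) auto
    qed (use insert arcD \<P> in auto)
    moreover have "\<Union>\<P> \<union> path_image (\<gamma> e) = drawing_points V (insert e E') pos \<gamma>"
      unfolding \<P> by (auto simp: drawing_points_def)
    ultimately show ?case by simp
  qed
  then show ?thesis using finite_E by blast
qed

text \<open>The faces are dense since the drawing has empty interior, and a finite union of closures
  is closed.\<close>

lemma Union_closure_faces: "(\<Union>F\<in>faces. closure F) = UNIV"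
proof -
  have "closed (\<Union>F\<in>faces. closure F)"
    using finite_faces by (intro closed_UN) auto
  moreover have "\<Union>faces \<subseteq> (\<Union>F\<in>faces. closure F)"
    using closure_subset by blast
  ultimately have "closure (\<Union>faces) \<subseteq> (\<Union>F\<in>faces. closure F)"
    by (intro closure_minimal)
  moreover have "closure (\<Union>faces) = UNIV"
    using interior_points by (simp add: closure_complement)
  ultimately show ?thesis by blast
qed

lemma vertex_on_face:
  assumes "v \<in> V"
  obtains F where "F \<in> faces" "on_face v F"
  using assms Union_closure_faces unfolding on_face_def by blast

lemma frontier_face: "F \<in> faces \<Longrightarrow> frontier F \<subseteq> points"
  using closed_points by (rule frontier_of_components_closed_complement)

text \<open>A face touching an arc at an inner point has the whole arc in its closure, including the
  ends. The edge depends only on \<open>p\<close>, so all faces at \<open>p\<close> share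
  it.\<close>

lemma edge_on_faces_at_point:
  assumes p: "p \<in> points" "p \<notin> pos ` V"
  obtains e where "e \<in> E"
    "\<And>G. G \<in> faces \<Longrightarrow> p \<in> closure G \<Longrightarrow> \<forall>v\<in>e. on_face v G"
proof -
  obtain e where e: "e \<in> E" "p \<in> path_image (\<gamma> e)"
    using p unfolding drawing_points_def by blast
  define K where "K = drawing_points V (E - {e}) pos \<gamma>"
  have K: "closed K" "path_image (\<gamma> e) \<inter> K = {pathstart (\<gamma> e), pathfinish (\<gamma> e)}"
    unfolding K_def using e(1)
    by (intro compact_imp_closed compact_points edge_meets_rest; blast)+
  have all: "K \<union> path_image (\<gamma> e) = points"
    using e(1) by (auto simp: K_def drawing_points_def)
  have "p \<notin> K"
    using K(2) e p(2) ends[OF e(1)] edgeD[OF e(1)] by blast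
  have "\<forall>v\<in>e. on_face v G" if G: "G \<in> faces" "p \<in> closure G" for G
  proof -
    have "path_image (\<gamma> e) \<subseteq> closure G"
      using arcD[OF e(1)] K in_components_subset[OF G(1)] frontier_face[OF G(1)] e(2) G(2) \<open>p \<notin> K\<close>
      by (intro arc_subset_closure[of _ K G p]) (auto simp: all)
    moreover have "pos ` e \<subseteq> path_image (\<gamma> e)"
      using edge_vertices[OF e(1)] by blast
    ultimately show ?thesis
      using edgeD[OF e(1)] unfolding on_face_def by blast
  qed
  with e(1) show ?thesis using that by blast
qed

text \<open>The closures of the faces with \<open>P\<close> and of those without form two closed
  sets covering the plane minus the vertices. The latter is connected, so they share a point
  \<open>p\<close> that is no vertex. Distinct faces being disjoint, \<open>p\<close> lies on an
  edge, which then borders both faces.\<close>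

lemma adjacent_faces_differ:
  assumes "F \<in> faces" "P F" "G \<in> faces" "\<not> P G"
  obtains F' G' e where "F' \<in> faces" "P F'" "G' \<in> faces" "\<not> P G'"
    "e \<in> E" "\<forall>v\<in>e. on_face v F' \<and> on_face v G'"
proof -
  define A where "A = (\<Union>F\<in>{F\<in>faces. P F}. closure F)"
  define B where "B = (\<Union>F\<in>{F\<in>faces. \<not> P F}. closure F)"
  have closed: "closed A" "closed B"
    unfolding A_def B_def using finite_faces by auto
  have cover: "- pos ` V \<subseteq> A \<union> B"
    using Union_closure_faces unfolding A_def B_def by blast
  have "\<exists>x\<in>closure H. x \<notin> pos ` V" if H: "H \<in> faces" for H
  proof -
    obtain x where "x \<in> H" using in_components_nonempty[OF H] by blast
    then show ?thesis
      using in_components_subset[OF H] closure_subset[of H] by (auto simp: drawing_points_def)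
  qed
  then obtain x y where xy: "x \<in> A" "y \<in> B" "x \<notin> pos ` V" "y \<notin> pos ` V"
    using assms unfolding A_def B_def by (metis (mono_tags, lifting) UN_I mem_Collect_eq)
  have "A \<inter> B \<inter> - pos ` V \<noteq> {}"
  proof
    assume "A \<inter> B \<inter> - pos ` V = {}"
    from connected_closedD[OF connected_Compl_vertices this cover closed] xy
    show False by (elim disjE) (simp_all add: disjoint_iff)
  qed
  then obtain p where "p \<in> A" "p \<in> B" and p: "p \<notin> pos ` V"
    unfolding ex_in_conv[symmetric] by (elim exE IntE) simp
  then obtain F' G' where F': "F' \<in> faces" "P F'" "p \<in> closure F'"
    and G': "G' \<in> faces" "\<not> P G'" "p \<in> closure G'"
    by (auto simp: A_def B_def)
  have "p \<in> points"
  proof (rule ccontr)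
    assume "p \<notin> points"
    then have "p \<in> F' \<inter> G'"
      using F' G' frontier_face[of F'] frontier_face[of G'] closure_Un_frontier[of F'] closure_Un_frontier[of G']
      by auto
    then show False
      using F' G' components_nonoverlap[OF F'(1) G'(1)] by auto
  qed
  then obtain e where "e \<in> E"
    "\<And>H. H \<in> faces \<Longrightarrow> p \<in> closure H \<Longrightarrow> \<forall>v\<in>e. on_face v H"
    using edge_on_faces_at_point[OF _ p] by metis
  then show ?thesis
    using that[of F' G' e] F' G' by blast
qed

section \<open>Connectivity of the cofaciality relation\<close>

lemma symp_cofacial: "symp cofacial"
  by (auto simp: symp_def cofacial_def)

text \<open>Otherwise a face with a vertex in \<open>A\<close> shares an edge with a face without
  one; the ends of this edge are outside \<open>A\<close> but cofacial with a vertex of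
  \<open>A\<close>.\<close>

lemma cofacial_connected:
  assumes "V \<noteq> {}"
  shows "conn cofacial V"
  unfolding conn_def
proof (intro conjI allI impI assms)
  fix A assume A: "A \<subseteq> V" "A \<noteq> {}" "A \<noteq> V"
  show "\<exists>a\<in>A. \<exists>b\<in>V - A. cofacial a b"
  proof (rule ccontr)
    assume no: "\<not> ?thesis"
    let ?P = "\<lambda>F. \<exists>a\<in>A. on_face a F"
    obtain a b where "a \<in> A" "b \<in> V - A" using A by blast
    then obtain F G where F: "F \<in> faces" "on_face a F" and G: "G \<in> faces" "on_face b G"
      using A vertex_on_face by (metis DiffD1 subsetD)
    have "?P F" "\<not> ?P G"
      using no \<open>a \<in> A\<close> \<open>b \<in> V - A\<close> F G by (auto simp: cofacial_def)
    from adjacent_faces_differ[of F ?P G, OF F(1) this(1) G(1) this(2)]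
    obtain F' G' e where FG: "F' \<in> faces" "?P F'" "G' \<in> faces" "\<not> ?P G'" "e \<in> E"
        "\<forall>v\<in>e. on_face v F' \<and> on_face v G'" .
    then obtain v where "v \<in> e" using edge_nonempty by blast
    then have "v \<in> V - A" "on_face v F'"
      using FG by (auto simp: on_face_def)
    then show False
      using no FG(1,2) by (auto simp: cofacial_def)
  qed
qed

text \<open>Otherwise no face could contain two vertices of \<open>J\<close> and one outside \<open>J\<close>. But some face has
  all its vertices in \<open>J\<close> and some other face has not, so two such faces share an edge.\<close>

lemma two_cofacial_neighbours:
  assumes J: "J \<subseteq> V" "J \<noteq> V" "conn cofacial J" "2 \<le> card J"
  shows "\<exists>v. v \<notin> J \<and> (\<exists>a\<in>J. \<exists>b\<in>J. a \<noteq> b \<and> cofacial v a \<and> cofacial v b)"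
proof (rule ccontr)
  assume no: "\<not> ?thesis"
  let ?P = "\<lambda>F. \<forall>v. on_face v F \<longrightarrow> v \<in> J"
  have pure: "?P F" if "F \<in> faces" "a \<in> J" "b \<in> J" "a \<noteq> b" "on_face a F" "on_face b F" for F a b
    using no that unfolding cofacial_def by blast
  obtain u where u: "u \<in> J" using J(3) by (auto simp: conn_def)
  have "{u} \<noteq> J" using J(4) by auto
  then obtain w where "w \<in> J - {u}" "cofacial u w"
    using J(3) u unfolding conn_def by (metis empty_subsetI insert_not_empty insert_subset singletonD)
  then obtain F where F: "F \<in> faces" "?P F"
    using pure u unfolding cofacial_def by blast
  obtain v where v: "v \<in> V" "v \<notin> J" using J(1,2) by blast
  then obtain G where G: "G \<in> faces" "\<not> ?P G" using vertex_on_face by metis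
  from adjacent_faces_differ[of F ?P G, OF F G]
  obtain F' G' e where FG: "F' \<in> faces" "?P F'" "G' \<in> faces" "\<not> ?P G'" "e \<in> E"
      "\<forall>v\<in>e. on_face v F' \<and> on_face v G'" .
  \<comment> \<open>Both ends of \<open>e\<close> are in \<open>J\<close> because of
    \<open>F'\<close>; as two vertices on \<open>G'\<close> they force \<open>?P G'\<close>.\<close>
  moreover obtain a b where "e = {a, b}" "a \<noteq> b"
    using edgeD[OF FG(5)] by (auto simp: card_2_iff)
  ultimately show False using pure[of G' a b] by blast
qed

section \<open>The outer face before and after deletions\<close>

lemma outside_face: "outside points \<in> faces"
  using connected_outside[of points] compact_points[of E V] unbounded_outside[of points]
  by (auto simp: outside_in_components compact_imp_bounded)

text \<open>The outer face is neither empty nor the whole plane, so it has a frontier point: a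
  vertex, or a point of an edge whose ends are then on this face.\<close>

lemma outer_vertex_exists:
  assumes "V \<noteq> {}"
  shows "\<exists>v. on_face v (outside points)"
proof -
  let ?F = "outside points"
  have "points \<noteq> {}" using assms by (auto simp: drawing_points_def)
  then have "?F \<noteq> UNIV" "?F \<noteq> {}"
    using outside_no_overlap[of points] in_components_nonempty[OF outside_face] by blast+
  then obtain p where p: "p \<in> frontier ?F"
    using frontier_eq_empty by blast
  then have "p \<in> points" "p \<in> closure ?F"
    using frontier_face[OF outside_face] by (auto simp: frontier_def)
  show ?thesis
  proof (cases "p \<in> pos ` V")
    case True
    then show ?thesis using \<open>p \<in> closure ?F\<close> by (auto simp: on_face_def)
  next
    case False
    then obtain e where "e \<in> E" "\<forall>v\<in>e. on_face v ?F"
      using edge_on_faces_at_point[OF \<open>p \<in> points\<close>] outside_face \<open>p \<in> closure ?F\<close> by metis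
    then show ?thesis using edge_nonempty by blast
  qed
qed

text \<open>Each exposed vertex lies on a face of the full drawing that is contained in the outer
  face of the remaining drawing \<open>Q\<close>. This holds by induction: a disc around a deleted
  vertex \<open>w\<close> misses \<open>Q\<close> and joins all faces at \<open>w\<close>.\<close>

lemma outerplane_if_exposed:
  assumes "V \<subseteq> exposed cofacial {v. on_face v (outside points)} W"
  shows "outerplane_drawing (V - W) (induced_edges E (V - W)) pos \<gamma>"
proof -
  define Q where "Q = drawing_points (V - W) (induced_edges E (V - W)) pos \<gamma>"
  have sub: "Q \<subseteq> points"
    by (auto simp: Q_def drawing_points_def induced_edges_def)
  have "closed Q"
    unfolding Q_def by (auto simp: induced_edges_def intro!: compact_imp_closed compact_points)
  have deleted: "pos w \<notin> Q" if "w \<in> V \<inter> W" for w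
  proof
    assume "pos w \<in> Q"
    then consider v where "v \<in> V - W" "pos w = pos v"
      | e where "e \<in> E" "e \<subseteq> V - W" "pos w \<in> path_image (\<gamma> e)"
      unfolding Q_def drawing_points_def induced_edges_def by blast
    then show False
    proof cases
      case 1
      then show ?thesis using inj_pos that by (auto dest: inj_onD)
    next
      case 2
      then have "pos w \<in> pos ` e" using edge_vertices that by blast
      then show ?thesis using 2 inj_pos that by (auto dest: inj_onD)
    qed
  qed
  have outer: "F \<subseteq> outside Q" if F: "F \<in> faces" "F \<inter> outside Q \<noteq> {}" for F
  proof
    fix y assume "y \<in> F"
    obtain x where x: "x \<in> F" "x \<in> outside Q" using F(2) by blast
    have "connected_component (- Q) x y"
      unfolding connected_component_def
      using in_components_connected[OF F(1)] in_components_subset[OF F(1)] sub x(1) \<open>y \<in> F\<close>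
      by blast
    then show "y \<in> outside Q" using x(2) outside_same_component by blast
  qed
  have reach: "\<exists>F\<in>faces. F \<subseteq> outside Q \<and> on_face v F"
    if "v \<in> exposed cofacial {v. on_face v (outside points)} W" for v
    using that
  proof induction
    case (start x)
    then show ?case using outside_face outside_mono[OF sub] by blast
  next
    case (step w v)
    then obtain F where F: "F \<in> faces" "F \<subseteq> outside Q" "on_face w F" by blast
    obtain G where G: "G \<in> faces" "on_face w G" "on_face v G"
      using step unfolding cofacial_def by blast
    have "pos w \<in> - Q" using deleted[of w] step F by (auto simp: on_face_def)
    have "open (- Q)" using \<open>closed Q\<close> by (rule open_Compl)
    then obtain e where e: "0 < e" "ball (pos w) e \<subseteq> - Q"
      using \<open>pos w \<in> - Q\<close> openE by blast
    have near: "\<exists>x\<in>H. x \<in> ball (pos w) e" if "on_face w H" for H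
      using that e(1) by (auto simp: on_face_def closure_approachable dist_commute)
    obtain x y where xy: "x \<in> F" "y \<in> G" "x \<in> ball (pos w) e" "y \<in> ball (pos w) e"
      using near[OF F(3)] near[OF G(2)] by blast
    have "connected_component (- Q) x y"
      unfolding connected_component_def using xy e(2) connected_ball by blast
    then have "y \<in> outside Q" using F(2) xy(1) outside_same_component by blast
    then show ?case using outer[OF G(1)] G xy(2) by blast
  qed
  have "pos v \<in> frontier (outside Q)" if v: "v \<in> V - W" for v
  proof -
    obtain F where "F \<subseteq> outside Q" "on_face v F" using reach[of v] assms v by auto
    then have "pos v \<in> closure (outside Q)"
      using closure_mono[of F "outside Q"] by (auto simp: on_face_def)
    moreover have "pos v \<in> Q" using v by (auto simp: Q_def drawing_points_def)
    then have "pos v \<notin> outside Q" using outside_no_overlap by blast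
    ultimately show ?thesis
      using interior_subset by (auto simp: frontier_def)
  qed
  then show ?thesis by (simp add: outerplane_drawing_def Q_def)
qed

end

theorem theorem2:
  fixes V :: "'v set" and E :: "'v set set"
    and pos :: "'v \<Rightarrow> complex" and \<gamma> :: "'v set \<Rightarrow> real \<Rightarrow> complex"
  assumes "plane_drawing V E pos \<gamma>"
  shows "\<exists>V'\<subseteq>V. real (card V') \<ge> real (card V) / 2 \<and>
           outerplane_drawing V' (induced_edges E V') pos \<gamma>"
proof (cases "V = {}")
  case True
  then show ?thesis by (auto simp: outerplane_drawing_def)
next
  case False
  interpret plane_graph V E pos \<gamma> using assms by unfold_locales
  let ?X = "{v. on_face v (outside points)}"
  have X: "?X \<subseteq> V" "?X \<noteq> {}" "\<And>u v. cofacial u v \<Longrightarrow> u \<in> V"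
    using outer_vertex_exists[OF False] by (auto simp: cofacial_def on_face_def)
  obtain W where W: "finite W" "2 * card W \<le> card V" "V \<subseteq> exposed cofacial ?X W"
    by (rule half_exposing_set[OF symp_cofacial finite_V X(1,2) cofacial_connected[OF False] X(3)
          two_cofacial_neighbours])
  have "card V - card W \<le> card (V - W)"
    using W(1) by (rule diff_card_le_card_Diff)
  then have "real (card V) / 2 \<le> real (card (V - W))"
    using W(2) by linarith
  then show ?thesis
    using outerplane_if_exposed[OF W(3)] by blast
qed

end
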